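(* Let $G$ be a connected strongly regular graph with parameters $(n,k,2,\mu)$, with $k\geq 3$, such that each vertex of $G$ is the central vertex of exactly one wheel in $G$. Then the anti-Gallai graph $\Delta(G)$ is connected and edge-regular.
   Context: All graphs are finite and simple. A $k$-regular graph $G$ on $n$ vertices is strongly regular with parameters $(n,k,\lambda,\mu)$ if $G$ is neither complete nor empty, any two adjacent vertices have exactly $\lambda$ common neighbours, and any two non-adjacent vertices have exactly $\mu$ common neighbours. An edge-regular graph with parameters $(n,k,\lambda)$ is a $k$-regular graph on $n$ vertices in which any two adjacent vertices have exactly $\lambda$ common neighbours. The wheel $W_m$ is obtained by joining a central vertex to all vertices of a cycle $C_m$; a wheel in $G$ with central vertex $u$ is a (not necessarily induced) subgraph of $G$ isomorphic to some $W_m$ with $u$ as centre. The anti-Gallai graph $\Delta(G)$ has the edges of $G$ as vertices, two being adjacent iff the corresponding edges lie on a common triangle of $G$. *)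

theory Defs
  imports "Graph_Theory.Kuratowski" "Graph_Theory.Digraph_Isomorphism"
begin

text \<open>
  A finite simple graph is a \<^locale>\<open>pair_graph\<close>: a finite, loop-free, symmetric digraph, in
  which every undirected edge \<open>{u, v}\<close> is represented by the two arcs \<open>(u, v)\<close> and \<open>(v, u)\<close>.
  The degree of a vertex is therefore its out-degree.
\<close>

definition common_neighbours :: "'a pair_pre_digraph \<Rightarrow> 'a \<Rightarrow> 'a \<Rightarrow> 'a set" where
  "common_neighbours G u v = {w \<in> pverts G. (u, w) \<in> parcs G \<and> (v, w) \<in> parcs G}"

definition regular_graph :: "'a pair_pre_digraph \<Rightarrow> nat \<Rightarrow> bool" where
  "regular_graph G k \<longleftrightarrow> pair_graph G \<and> (\<forall>v \<in> pverts G. out_degree (with_proj G) v = k)"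

definition edge_regular :: "'a pair_pre_digraph \<Rightarrow> nat \<Rightarrow> nat \<Rightarrow> nat \<Rightarrow> bool" where
  "edge_regular G n k l \<longleftrightarrow>
     regular_graph G k \<and> card (pverts G) = n \<and>
     (\<forall>u v. (u, v) \<in> parcs G \<longrightarrow> card (common_neighbours G u v) = l)"

definition strongly_regular :: "'a pair_pre_digraph \<Rightarrow> nat \<Rightarrow> nat \<Rightarrow> nat \<Rightarrow> nat \<Rightarrow> bool" where
  "strongly_regular G n k l m \<longleftrightarrow>
     regular_graph G k \<and> card (pverts G) = n \<and>
     \<not> complete_digraph n (with_proj G) \<and> parcs G \<noteq> {} \<and>
     (\<forall>u v. (u, v) \<in> parcs G \<longrightarrow> card (common_neighbours G u v) = l) \<and>
     (\<forall>u \<in> pverts G. \<forall>v \<in> pverts G. u \<noteq> v \<and> (u, v) \<notin> parcs G \<longrightarrow>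
        card (common_neighbours G u v) = m)"

definition cycle_graph :: "nat \<Rightarrow> nat pair_pre_digraph" where
  "cycle_graph m = \<lparr> pverts = {..<m},
     parcs = {(i, j). i < m \<and> j < m \<and> (j = Suc i mod m \<or> i = Suc j mod m)} \<rparr>"

text \<open>
  In the wheel on \<open>m\<close> spokes the centre is \<^term>\<open>None\<close>, and the rim vertices are \<^term>\<open>Some i\<close>
  for \<open>i < m\<close>. It is a simple graph, with a rim that is a cycle of length \<open>m\<close>, only for \<open>m \<ge> 3\<close>.
\<close>

definition wheel_graph :: "nat \<Rightarrow> nat option pair_pre_digraph" where
  "wheel_graph m = \<lparr> pverts = insert None (Some ` pverts (cycle_graph m)),
     parcs = {(None, Some i) | i. i \<in> pverts (cycle_graph m)}
           \<union> {(Some i, None) | i. i \<in> pverts (cycle_graph m)}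
           \<union> {(Some i, Some j) | i j. (i, j) \<in> parcs (cycle_graph m)} \<rparr>"

definition wheel_in :: "'a pair_pre_digraph \<Rightarrow> 'a \<Rightarrow> 'a pair_pre_digraph \<Rightarrow> bool" where
  "wheel_in G u W \<longleftrightarrow> subgraph (with_proj W) (with_proj G) \<and>
     (\<exists>m \<ge> 3. \<exists>h. pre_digraph.digraph_isomorphism (with_proj (wheel_graph m)) h \<and>
        with_proj W = app_iso h (with_proj (wheel_graph m)) \<and> iso_verts h None = u)"

definition triangle :: "'a pair_pre_digraph \<Rightarrow> 'a set \<Rightarrow> bool" where
  "triangle G T \<longleftrightarrow>
     (\<exists>u v w. T = {u, v, w} \<and> (u, v) \<in> parcs G \<and> (v, w) \<in> parcs G \<and> (u, w) \<in> parcs G)"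

definition edges :: "'a pair_pre_digraph \<Rightarrow> 'a set set" where
  "edges G = {{u, v} | u v. (u, v) \<in> parcs G}"

definition anti_gallai :: "'a pair_pre_digraph \<Rightarrow> 'a set pair_pre_digraph" where
  "anti_gallai G = \<lparr> pverts = edges G,
     parcs = {(e, f). e \<in> edges G \<and> f \<in> edges G \<and> e \<noteq> f \<and>
                (\<exists>T. triangle G T \<and> e \<subseteq> T \<and> f \<subseteq> T)} \<rparr>"

end

theory Submission
  imports Defs
begin

text \<open>
  Since \<open>\<lambda> = 2\<close>, every neighbourhood \<open>N(u)\<close> induces a 2-regular graph, and wheels centred at \<open>u\<close>
  are cycles in it. If \<open>N(u)\<close> were disconnected, it would contain two cycles and \<open>u\<close> would be the
  centre of two wheels; so \<open>N(u)\<close> is connected. Hence all edges at \<open>u\<close> lie in one component of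
  \<open>\<Delta>(G)\<close>, and connectedness of \<open>G\<close> gives that of \<open>\<Delta>(G)\<close>.
  Every edge lies on two triangles, so \<open>\<Delta>(G)\<close> is 4-regular. Adjacent vertices \<open>ab\<close>, \<open>ac\<close> of \<open>\<Delta>(G)\<close>
  have the common neighbour \<open>bc\<close>, and any other is an edge \<open>ad\<close> such that \<open>a\<close>, \<open>b\<close>, \<open>c\<close>, \<open>d\<close> form a
  \<open>K\<^sub>4\<close>. A \<open>K\<^sub>4\<close> through \<open>a\<close> gives a component \<open>{b, c, d}\<close> of \<open>N(a)\<close>, hence occurs only for
  \<open>k = 3\<close>, and then every triangle lies in exactly one \<open>K\<^sub>4\<close>.
\<close>

section \<open>Cycles from minimum degree two\<close>

text \<open>Prepending to a longest path in \<open>S\<close> is impossible, so its first vertex has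
  all its neighbours in \<open>S\<close> on the path; one of two such neighbours is far enough along
  to close a cycle.\<close>

lemma min_degree_two_imp_cycle:
  fixes S :: "'a set" and r :: "'a rel"
  assumes "finite S" and "S \<noteq> {}" and "sym r" and irr: "\<And>x. (x, x) \<notin> r"
    and deg: "\<And>x. x \<in> S \<Longrightarrow> \<exists>y\<in>S. \<exists>z\<in>S. y \<noteq> z \<and> (x, y) \<in> r \<and> (x, z) \<in> r"
  obtains m f where "m \<ge> 3" and "inj_on f {..<m}" and "f ` {..<m} \<subseteq> S"
    and "\<And>i. i < m \<Longrightarrow> (f i, f (Suc i mod m)) \<in> r"
proof -
  define P where "P xs \<longleftrightarrow> xs \<noteq> [] \<and> distinct xs \<and> set xs \<subseteq> S \<and>
    (\<forall>i. Suc i < length xs \<longrightarrow> (xs ! i, xs ! Suc i) \<in> r)" for xs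
  obtain x0 where "x0 \<in> S" using \<open>S \<noteq> {}\<close> by auto
  then have "P [x0]" by (simp add: P_def)
  moreover have "length xs < Suc (card S)" if "P xs" for xs
    using that card_mono[OF \<open>finite S\<close>, of "set xs"] by (simp add: P_def distinct_card)
  ultimately obtain xs where xs: "P xs" and longest: "\<And>ys. P ys \<Longrightarrow> length ys \<le> length xs"
    using ex_has_greatest_nat[of P "[x0]" length "Suc (card S)"] by (metis less_or_eq_imp_le)
  let ?x = "xs ! 0"
  have "?x \<in> S" using xs by (auto simp: P_def)
  have in_path: "y \<in> set xs" if "y \<in> S" "(?x, y) \<in> r" for y
  proof (rule ccontr)
    assume "y \<notin> set xs"
    moreover have "((y # xs) ! i, (y # xs) ! Suc i) \<in> r" if "Suc i < length (y # xs)" for i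
      using that xs \<open>(?x, y) \<in> r\<close> symD[OF \<open>sym r\<close>] by (cases i) (auto simp: P_def)
    ultimately have "P (y # xs)" using xs \<open>y \<in> S\<close> by (auto simp: P_def)
    then show False using longest by fastforce
  qed
  obtain y z where yz: "y \<in> S" "z \<in> S" "y \<noteq> z" "(?x, y) \<in> r" "(?x, z) \<in> r"
    using deg[OF \<open>?x \<in> S\<close>] by blast
  obtain i j where ij: "i < length xs" "y = xs ! i" "j < length xs" "z = xs ! j"
    using in_path yz by (metis in_set_conv_nth)
  have "i \<noteq> j" "i \<noteq> 0" "j \<noteq> 0" using yz(3-5) ij(2,4) irr by metis+
  \<comment> \<open>Distinct nonzero indices cannot both be 1.\<close>
  then have "\<exists>l. 2 \<le> l \<and> l < length xs \<and> (xs ! l, ?x) \<in> r"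
    using ij yz symD[OF \<open>sym r\<close>]
    by (cases "2 \<le> i") (auto intro: exI[of _ i] exI[of _ j])
  then obtain l where l: "2 \<le> l" "l < length xs" "(xs ! l, ?x) \<in> r" by blast
  show thesis
  proof (rule that[of "Suc l" "(!) xs"])
    show "3 \<le> Suc l" using l by simp
    show "inj_on ((!) xs) {..<Suc l}"
      using xs l by (auto simp: P_def inj_on_def nth_eq_iff_index_eq)
    show "(!) xs ` {..<Suc l} \<subseteq> S"
      using xs l by (auto simp: P_def)
    fix i assume "i < Suc l"
    \<comment> \<open>The cycle has the indices 0 to \<open>l\<close>; at \<open>i = l\<close> the
      modulus wraps round to 0, and the closing arc is used.\<close>
    then show "(xs ! i, xs ! (Suc i mod Suc l)) \<in> r"
      using xs l by (cases "i = l") (auto simp: P_def)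
  qed
qed

section \<open>Wheels from cycles in a neighbourhood\<close>

text \<open>The wheel is the image of the standard one under \<open>None\<close> to
  \<open>u\<close>, \<open>Some i\<close> to \<open>f i\<close>. This map is injective because
  \<open>f\<close> is and, without loops, no neighbour \<open>f i\<close> of \<open>u\<close> equals
  \<open>u\<close>.\<close>

lemma wheel_of_cycle:
  assumes "pair_graph G" and "m \<ge> 3" and inj: "inj_on f {..<m}"
    and spokes: "\<And>i. i < m \<Longrightarrow> (u, f i) \<in> parcs G"
    and rim: "\<And>i. i < m \<Longrightarrow> (f i, f (Suc i mod m)) \<in> parcs G"
  obtains W where "wheel_in G u W" and "pverts W = insert u (f ` {..<m})"
proof -
  interpret pair_graph G by fact
  define g where "g = case_option u f"
  have [simp]: "g None = u" "g (Some i) = f i" for i by (auto simp: g_def)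
  define W where "W = \<lparr> pverts = g ` pverts (wheel_graph m),
    parcs = map_prod g g ` parcs (wheel_graph m) \<rparr>"
  \<comment> \<open>Tail and head are the projections, so that \<open>app_iso h\<close> yields
    literally \<open>with_proj W\<close>.\<close>
  define h :: "(nat option, nat option \<times> nat option, 'a, 'a \<times> 'a) digraph_isomorphism"
    where "h = \<lparr> iso_verts = g, iso_arcs = map_prod g g, iso_head = snd, iso_tail = fst \<rparr>"
  have arcs_sub: "parcs (wheel_graph m) \<subseteq> pverts (wheel_graph m) \<times> pverts (wheel_graph m)"
    by (auto simp: wheel_graph_def cycle_graph_def)
  have inj_g: "inj_on g (pverts (wheel_graph m))"
    using inj spokes no_loops'
    by (fastforce simp: wheel_graph_def cycle_graph_def inj_on_def)
  have vW: "pverts W = insert u (f ` {..<m})"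
    by (auto simp: W_def wheel_graph_def cycle_graph_def image_image)
  have "parcs W \<subseteq> parcs G"
    using spokes rim arcs_symmetric
    by (auto simp: W_def wheel_graph_def cycle_graph_def)
  moreover have "pverts W \<subseteq> pverts G"
  proof -
    have "(u, f 0) \<in> parcs G" using spokes \<open>m \<ge> 3\<close> by simp
    then show ?thesis using spokes by (auto simp: vW dest: in_arcsD1 in_arcsD2)
  qed
  moreover have "wf_digraph (with_proj W)"
    using arcs_sub by unfold_locales (auto simp: W_def)
  ultimately have "subgraph (with_proj W) (with_proj G)"
    using wf_digraph by (auto simp: subgraph_def)
  moreover have "pre_digraph.digraph_isomorphism (with_proj (wheel_graph m)) h"
  proof -
    have "wf_digraph (with_proj (wheel_graph m))"
      using arcs_sub by unfold_locales auto
    moreover have "inj_on (map_prod g g) (parcs (wheel_graph m))"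
      using inj_on_subset[OF map_prod_inj_on[OF inj_g inj_g] arcs_sub] .
    ultimately show ?thesis
      using inj_g by (auto simp: pre_digraph.digraph_isomorphism_def h_def)
  qed
  moreover have "with_proj W = app_iso h (with_proj (wheel_graph m))"
    by (simp add: with_proj_def app_iso_def W_def h_def)
  moreover have "iso_verts h None = u" by (simp add: h_def)
  ultimately have "wheel_in G u W" using \<open>m \<ge> 3\<close> by (auto simp: wheel_in_def)
  with vW show thesis by (rule that[rotated])
qed

section \<open>Reachability, degrees and edges\<close>

text \<open>\<open>connected\<close> refers to the symmetric closure, which has the same
  reachability when the arcs are already symmetric.\<close>

lemma (in pair_sym_digraph) connected_iff_reachable:
  "connected (with_proj G) \<longleftrightarrow>
    pverts G \<noteq> {} \<and> (\<forall>u \<in> pverts G. \<forall>v \<in> pverts G. u \<rightarrow>\<^sup>*\<^bsub>with_proj G\<^esub> v)"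
  using reachable_mk_symmetric_eq[OF sym_arcs]
  by (simp add: connected_def strongly_connected_def mk_symmetric_def)

lemma card_neighbours: "card {v. (u, v) \<in> parcs G} = out_degree (with_proj G) u"
proof -
  have "out_arcs (with_proj G) u = Pair u ` {v. (u, v) \<in> parcs G}"
    by (auto simp: out_arcs_def)
  then show ?thesis by (simp add: out_degree_def card_image inj_on_def)
qed

lemma edgesI: "(u, v) \<in> parcs G \<Longrightarrow> {u, v} \<in> edges G"
  by (auto simp: edges_def)

section \<open>Connectedness of neighbourhoods\<close>

text \<open>The common neighbours of \<open>u\<close> and \<open>v\<close> are the neighbours of
  \<open>v\<close> inside N(u), so the first assumption makes N(u) 2-regular. The second keeps N(u)
  from splitting into several components.\<close>

locale unique_wheel_graph = pair_graph G for G :: "'a pair_pre_digraph" +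
  assumes card_common_neighbours: "(u, v) \<in> parcs G \<Longrightarrow> card (common_neighbours G u v) = 2"
    and wheel_unique: "wheel_in G u W \<Longrightarrow> wheel_in G u W' \<Longrightarrow> W = W'"
begin

lemma arc_commute: "(u, v) \<in> parcs G \<longleftrightarrow> (v, u) \<in> parcs G"
  using arcs_symmetric by blast

lemma no_loop [simp]: "(u, u) \<notin> parcs G"
  using no_loops' by blast

lemma mem_common_neighbours_iff:
  "w \<in> common_neighbours G u v \<longleftrightarrow> (u, w) \<in> parcs G \<and> (v, w) \<in> parcs G"
  by (auto simp: common_neighbours_def dest: in_arcsD2)

lemma finite_neighbours: "finite {v. (u, v) \<in> parcs G}"
  using pair_finite_verts by (rule finite_subset[rotated]) (auto dest: in_arcsD2)

text \<open>Here \<open>S\<close> is a union of components of N(u), so each of its vertices has both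
  its N(u)-neighbours in \<open>S\<close>, and \<open>S\<close> contains a cycle. That
  \<open>W\<close> meets \<open>S\<close> serves to tell apart wheels from disjoint sets.\<close>

lemma closed_imp_contains_wheel:
  assumes "S \<noteq> {}" and nbr: "S \<subseteq> {x. (u, x) \<in> parcs G}"
    and closed: "\<And>x y. x \<in> S \<Longrightarrow> (u, y) \<in> parcs G \<Longrightarrow> (x, y) \<in> parcs G \<Longrightarrow> y \<in> S"
  obtains W where "wheel_in G u W" and "pverts W \<subseteq> insert u S" and "pverts W \<inter> S \<noteq> {}"
proof -
  have fin: "finite S" using nbr finite_neighbours by (rule finite_subset)
  have sym: "sym (parcs G)" using arc_commute by (auto intro: symI)
  have deg: "\<exists>y\<in>S. \<exists>z\<in>S. y \<noteq> z \<and> (x, y) \<in> parcs G \<and> (x, z) \<in> parcs G" if "x \<in> S" for x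
  proof -
    have "card (common_neighbours G u x) = 2" using that nbr card_common_neighbours by blast
    then obtain y z where "y \<noteq> z" "common_neighbours G u x = {y, z}" by (auto simp: card_2_iff)
    then show ?thesis using that closed mem_common_neighbours_iff by (metis insert_iff)
  qed
  obtain m f where c: "m \<ge> 3" "inj_on f {..<m}" "f ` {..<m} \<subseteq> S"
    "\<And>i. i < m \<Longrightarrow> (f i, f (Suc i mod m)) \<in> parcs G"
    using min_degree_two_imp_cycle[OF fin \<open>S \<noteq> {}\<close> sym no_loop deg] by metis
  have "(u, f i) \<in> parcs G" if "i < m" for i using that c nbr by auto
  then obtain W where "wheel_in G u W" "pverts W = insert u (f ` {..<m})"
    using wheel_of_cycle[OF pair_graph c(1,2) _ c(4)] by metis
  moreover have "f 0 \<in> S" "f 0 \<in> f ` {..<m}" using c by auto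
  ultimately show thesis using c(3) by (intro that[of W]) auto
qed

text \<open>By symmetry the complement of \<open>R\<close> in N(u) is closed as well; were it
  nonempty, both sets would carry a wheel around \<open>u\<close>. The lemma acts as an induction
  principle over N(u).\<close>

lemma neighbourhood_connected:
  assumes "R \<noteq> {}" and nbr: "R \<subseteq> {x. (u, x) \<in> parcs G}"
    and closed: "\<And>x y. x \<in> R \<Longrightarrow> (u, y) \<in> parcs G \<Longrightarrow> (x, y) \<in> parcs G \<Longrightarrow> y \<in> R"
  shows "R = {x. (u, x) \<in> parcs G}"
proof (rule ccontr)
  let ?S = "{x. (u, x) \<in> parcs G} - R"
  assume "R \<noteq> {x. (u, x) \<in> parcs G}"
  then have "?S \<noteq> {}" using nbr by blast
  moreover have "y \<in> ?S" if "x \<in> ?S" "(u, y) \<in> parcs G" "(x, y) \<in> parcs G" for x y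
    using that closed arc_commute by blast
  moreover have "?S \<subseteq> {x. (u, x) \<in> parcs G}" by blast
  ultimately obtain W' where W': "wheel_in G u W'" "pverts W' \<subseteq> insert u ?S" "pverts W' \<inter> ?S \<noteq> {}"
    using closed_imp_contains_wheel[of ?S u] by metis
  obtain W where W: "wheel_in G u W" "pverts W \<subseteq> insert u R" "pverts W \<inter> R \<noteq> {}"
    using closed_imp_contains_wheel[OF assms(1,2)] closed by metis
  \<comment> \<open>Lying in both bounds, the common wheel could have no vertex but
    \<open>u\<close>, yet it meets \<open>R\<close>, which omits \<open>u\<close>.\<close>
  have "W = W'" using W W' wheel_unique by blast
  then show False using W W' by auto
qed

section \<open>Adjacency in the anti-Gallai graph\<close>

text \<open>The three vertices of a triangle are distinct, as there are no loops. Hence for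
  \<open>c\<close> equal to \<open>a\<close> or \<open>b\<close> both sides fail.\<close>

lemma triangle_common_neighbours_iff:
  assumes "(a, b) \<in> parcs G"
  shows "triangle G {a, b, c} \<longleftrightarrow> c \<in> common_neighbours G a b"
proof
  assume "triangle G {a, b, c}"
  then obtain u v w where T: "{a, b, c} = {u, v, w}"
    and arcs: "(u, v) \<in> parcs G" "(v, w) \<in> parcs G" "(u, w) \<in> parcs G"
    by (auto simp: triangle_def)
  have adj: "(x, y) \<in> parcs G" if "x \<in> {a, b, c}" "y \<in> {a, b, c}" "x \<noteq> y" for x y
    using that arcs arcs[THEN arcs_symmetric] unfolding T by blast
  have "u \<noteq> v" "v \<noteq> w" "u \<noteq> w" using arcs by auto
  then have "card {a, b, c} = 3" unfolding T by simp
  then have "c \<noteq> a" "c \<noteq> b" by (auto simp: card_insert_if split: if_splits)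
  then show "c \<in> common_neighbours G a b"
    using adj by (simp add: mem_common_neighbours_iff)
next
  assume "c \<in> common_neighbours G a b"
  then show "triangle G {a, b, c}"
    using assms unfolding triangle_def mem_common_neighbours_iff by blast
qed

text \<open>Two distinct sides of a triangle share one corner. Naming it \<open>a\<close> gives a
  normal form for arcs that replaces the set \<open>T\<close> by adjacencies in
  \<open>G\<close>.\<close>

lemma anti_gallai_arc_iff:
  "(e, f) \<in> parcs (anti_gallai G) \<longleftrightarrow>
    (\<exists>a b c. e = {a, b} \<and> f = {a, c} \<and>
      (a, b) \<in> parcs G \<and> (a, c) \<in> parcs G \<and> (b, c) \<in> parcs G)" (is "?L \<longleftrightarrow> ?R")
proof
  assume ?L
  then obtain T where ef: "e \<in> edges G" "f \<in> edges G" "e \<noteq> f"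
    and T: "triangle G T" "e \<subseteq> T" "f \<subseteq> T"
    by (auto simp: anti_gallai_def)
  obtain a b where ab: "e = {a, b}" "(a, b) \<in> parcs G" using ef by (auto simp: edges_def)
  obtain c d where cd: "f = {c, d}" "(c, d) \<in> parcs G" using ef by (auto simp: edges_def)
  have ne: "a \<noteq> b" "c \<noteq> d" using ab cd by auto
  obtain t where t: "T = {a, b, t}" "t \<in> common_neighbours G a b"
  proof -
    obtain u v w where "T = {u, v, w}" using T by (auto simp: triangle_def)
    then have "\<exists>t. T = {a, b, t}" using T(2) ab(1) ne by auto
    then show thesis using that T(1) triangle_common_neighbours_iff[OF ab(2)] by blast
  qed
  have "c \<in> {a, b, t}" "d \<in> {a, b, t}" using T(3) cd(1) t(1) by auto
  \<comment> \<open>Of the three pairs in \<open>{a, b, t}\<close>, \<open>f\<close> is one other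
    than \<open>e\<close>.\<close>
  then have "f = {a, t} \<or> f = {b, t}"
    using ef(3) ne(2) unfolding ab(1) cd(1) by (auto simp: insert_commute)
  then show ?R
  proof
    assume "f = {a, t}"
    then show ?R using ab t by (auto simp: mem_common_neighbours_iff)
  next
    assume "f = {b, t}"
    \<comment> \<open>The shared corner is now \<open>b\<close>, so the witnesses are
      \<open>b\<close>, \<open>a\<close>, \<open>t\<close>.\<close>
    then have "e = {b, a} \<and> f = {b, t} \<and> (b, a) \<in> parcs G \<and> (b, t) \<in> parcs G \<and> (a, t) \<in> parcs G"
      using ab(1) t(2) \<open>f = {b, t}\<close> arcs_symmetric[OF ab(2)]
      by (simp add: mem_common_neighbours_iff insert_commute)
    then show ?R by blast
  qed
next
  assume ?R
  then obtain a b c where abc: "e = {a, b}" "f = {a, c}" "(a, b) \<in> parcs G" "(a, c) \<in> parcs G"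
    "(b, c) \<in> parcs G" by blast
  then have "triangle G {a, b, c}" unfolding triangle_def by blast
  moreover have "e \<noteq> f" using abc by (auto simp: doubleton_eq_iff)
  moreover have "e \<in> edges G" "f \<in> edges G" using abc edgesI by metis+
  ultimately show ?L using abc by (auto simp: anti_gallai_def)
qed

lemma anti_gallai_arcI:
  assumes "(a, b) \<in> parcs G" "(a, c) \<in> parcs G" "(b, c) \<in> parcs G"
  shows "({a, b}, {a, c}) \<in> parcs (anti_gallai G)"
  unfolding anti_gallai_arc_iff using assms by blast

lemma anti_gallai_neighbour_iff:
  assumes "(a, b) \<in> parcs G"
  shows "({a, b}, f) \<in> parcs (anti_gallai G) \<longleftrightarrow>
    (\<exists>c \<in> common_neighbours G a b. f = {a, c} \<or> f = {b, c})" (is "?L \<longleftrightarrow> ?R")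
proof
  assume ?L
  then obtain a' b' c where "{a, b} = {a', b'}" "f = {a', c}"
    and "(a', c) \<in> parcs G" "(b', c) \<in> parcs G"
    unfolding anti_gallai_arc_iff by blast
  then show ?R
    by (auto simp: doubleton_eq_iff mem_common_neighbours_iff)
next
  assume ?R
  then obtain c where c: "(a, c) \<in> parcs G" "(b, c) \<in> parcs G" "f = {a, c} \<or> f = {b, c}"
    by (auto simp: mem_common_neighbours_iff)
  then show ?L
    using assms anti_gallai_arcI[of a b c] anti_gallai_arcI[of b a c] arcs_symmetric[OF assms]
    by (auto simp: insert_commute)
qed

section \<open>Degrees in the anti-Gallai graph\<close>

lemma pair_graph_anti_gallai: "pair_graph (anti_gallai G)"
proof unfold_locales
  have "edges G = (\<lambda>(u, v). {u, v}) ` parcs G" by (auto simp: edges_def)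
  then have fin: "finite (edges G)" using pair_finite_arcs by simp
  then show "finite (pverts (anti_gallai G))" by (simp add: anti_gallai_def)
  have "parcs (anti_gallai G) \<subseteq> edges G \<times> edges G" by (auto simp: anti_gallai_def)
  then show "finite (parcs (anti_gallai G))" using fin by (simp add: finite_subset)
qed (auto simp: anti_gallai_def symmetric_def sym_def)

text \<open>Each of the two triangles on an edge contributes its two other sides; the two triangles
  share no further side.\<close>

lemma out_degree_anti_gallai:
  assumes "e \<in> edges G"
  shows "out_degree (with_proj (anti_gallai G)) e = 4"
proof -
  obtain a b where ab: "e = {a, b}" "(a, b) \<in> parcs G" using assms by (auto simp: edges_def)
  obtain c d where cd: "c \<noteq> d" "common_neighbours G a b = {c, d}"
    using card_common_neighbours[OF ab(2)] by (auto simp: card_2_iff)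
  then have arcs: "(a, c) \<in> parcs G" "(b, c) \<in> parcs G" "(a, d) \<in> parcs G" "(b, d) \<in> parcs G"
    using mem_common_neighbours_iff by blast+
  have "a \<noteq> b" "a \<noteq> c" "b \<noteq> c" "a \<noteq> d" "b \<noteq> d" using ab arcs by auto
  then have "card {{a, c}, {b, c}, {a, d}, {b, d}} = 4"
    using cd(1) by (simp add: card_insert_if doubleton_eq_iff)
  moreover have "{f. (e, f) \<in> parcs (anti_gallai G)} = {{a, c}, {b, c}, {a, d}, {b, d}}"
    unfolding ab(1) anti_gallai_neighbour_iff[OF ab(2)] cd(2) by blast
  ultimately show ?thesis by (simp flip: card_neighbours)
qed

section \<open>Common neighbours in the anti-Gallai graph\<close>

text \<open>A common neighbour through \<open>a\<close> is an edge to some \<open>d\<close>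
  completing a \<open>K4\<close> with \<open>a\<close>, \<open>b\<close>, \<open>c\<close>; one
  avoiding \<open>a\<close> meets both given edges and must be the third side.\<close>

lemma common_neighbours_anti_gallai:
  assumes "(a, b) \<in> parcs G" "(a, c) \<in> parcs G" "(b, c) \<in> parcs G"
  shows "common_neighbours (anti_gallai G) {a, b} {a, c} =
    insert {b, c} ((\<lambda>d. {a, d}) ` {d. (a, d) \<in> parcs G \<and> (b, d) \<in> parcs G \<and> (c, d) \<in> parcs G})"
proof -
  have ne: "a \<noteq> b" "a \<noteq> c" "b \<noteq> c" using assms by auto
  interpret H: pair_graph "anti_gallai G" by (rule pair_graph_anti_gallai)
  have "g \<in> common_neighbours (anti_gallai G) {a, b} {a, c} \<longleftrightarrow>
      (\<exists>d. (a, d) \<in> parcs G \<and> (b, d) \<in> parcs G \<and> (g = {a, d} \<or> g = {b, d})) \<and>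
      (\<exists>d. (a, d) \<in> parcs G \<and> (c, d) \<in> parcs G \<and> (g = {a, d} \<or> g = {c, d}))" for g
    using anti_gallai_neighbour_iff[OF assms(1), of g] anti_gallai_neighbour_iff[OF assms(2), of g]
    unfolding Bex_def mem_common_neighbours_iff
    by (auto simp: common_neighbours_def dest: H.in_arcsD2)
  moreover have "(\<exists>d. (a, d) \<in> parcs G \<and> (b, d) \<in> parcs G \<and> (g = {a, d} \<or> g = {b, d})) \<and>
      (\<exists>d. (a, d) \<in> parcs G \<and> (c, d) \<in> parcs G \<and> (g = {a, d} \<or> g = {c, d})) \<longleftrightarrow>
      g = {b, c} \<or> (\<exists>d. (a, d) \<in> parcs G \<and> (b, d) \<in> parcs G \<and> (c, d) \<in> parcs G \<and> g = {a, d})"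
    (is "?L g \<longleftrightarrow> ?R g") for g
  proof
    assume "?L g"
    then obtain d d' where
      d: "(a, d) \<in> parcs G" "(b, d) \<in> parcs G" "g = {a, d} \<or> g = {b, d}" and
      d': "(a, d') \<in> parcs G" "(c, d') \<in> parcs G" "g = {a, d'} \<or> g = {c, d'}"
      by blast
    have "a \<noteq> d" "a \<noteq> d'" using d(1) d'(1) no_loop by metis+
    \<comment> \<open>The mixed cases, with \<open>a\<close> in only one of the two forms of
      \<open>g\<close>, are contradictory; the forms \<open>{b, d}\<close> and
      \<open>{c, d'}\<close> agree only for \<open>d = c\<close> and \<open>d' = b\<close>.\<close>
    then have "g = {b, c} \<or> g = {a, d} \<and> d = d'"
      using d(3) d'(3) ne by (metis doubleton_eq_iff)
    then show "?R g" using d(1,2) d'(2) by metis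
  next
    assume "?R g"
    then show "?L g"
    proof
      assume "g = {b, c}"
      then have "g = {c, b}" by (simp add: insert_commute)
      then show "?L g" using \<open>g = {b, c}\<close> assms arcs_symmetric[OF assms(3)] by metis
    qed metis
  qed
  ultimately have "g \<in> common_neighbours (anti_gallai G) {a, b} {a, c} \<longleftrightarrow> ?R g" for g
    by (rule trans)
  then show ?thesis by (intro set_eqI) (simp only: insert_iff image_iff Bex_def mem_Collect_eq conj_assoc)
qed

text \<open>If \<open>a\<close> has degree 3, the 2-regular graph on N(a) is a triangle, so the
  third neighbour completes a \<open>K4\<close>. Conversely, any \<open>K4\<close> through
  \<open>a\<close> cuts out a closed triangle in N(a), which by connectedness is all of
  N(a).\<close>

lemma card_tetrahedra_on_triangle:
  assumes arcs: "(a, b) \<in> parcs G" "(a, c) \<in> parcs G" "(b, c) \<in> parcs G"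
  shows "card {d. (a, d) \<in> parcs G \<and> (b, d) \<in> parcs G \<and> (c, d) \<in> parcs G} =
    (if out_degree (with_proj G) a = 3 then 1 else 0)" (is "card ?D = _")
proof (cases "out_degree (with_proj G) a = 3")
  case True
  let ?N = "{x. (a, x) \<in> parcs G}"
  have "card ?N = 3" using True by (simp add: card_neighbours)
  moreover have "b \<in> ?N" "c \<in> ?N" "b \<noteq> c" using arcs by auto
  ultimately have "card (?N - {b, c}) = 1" by (simp add: card_Diff_subset)
  then obtain d where d: "?N - {b, c} = {d}" by (rule card_1_singletonE)
  have "d \<in> common_neighbours G a x" if x: "x \<in> {b, c}" for x
  proof -
    have "(a, x) \<in> parcs G" using x arcs by auto
    \<comment> \<open>Only two neighbours of \<open>a\<close> differ from \<open>x\<close>, and two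
      common neighbours are required: both must occur, \<open>d\<close> among them.\<close>
    have "common_neighbours G a x \<subseteq> ({b, c} - {x}) \<union> {d}"
    proof
      fix y assume "y \<in> common_neighbours G a x"
      then have "y \<in> ?N" "y \<noteq> x" by (auto simp: mem_common_neighbours_iff)
      then show "y \<in> ({b, c} - {x}) \<union> {d}" using d by blast
    qed
    moreover have "card (({b, c} - {x}) \<union> {d}) \<le> 2"
      using x by (auto simp: card_insert_if)
    ultimately have "common_neighbours G a x = ({b, c} - {x}) \<union> {d}"
      using card_common_neighbours[OF \<open>(a, x) \<in> parcs G\<close>] by (intro card_seteq) auto
    then show ?thesis by blast
  qed
  then have "d \<in> ?D" unfolding mem_common_neighbours_iff by blast
  moreover have "?D \<subseteq> ?N - {b, c}" by auto
  ultimately have "?D = {d}" unfolding d by blast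
  then show ?thesis using True by simp
next
  case False
  have "?D = {}"
  proof (rule ccontr)
    assume "?D \<noteq> {}"
    then obtain d where d: "(a, d) \<in> parcs G" "(b, d) \<in> parcs G" "(c, d) \<in> parcs G" by blast
    have ne: "b \<noteq> c" "b \<noteq> d" "c \<noteq> d" using arcs(3) d(2,3) no_loop by metis+
    have cn: "common_neighbours G a x = {b, c, d} - {x}" if x: "x \<in> {b, c, d}" for x
    proof (rule card_seteq[symmetric])
      have "(a, x) \<in> parcs G" using x arcs(1,2) d(1) by blast
      note c2 = card_common_neighbours[OF this]
      \<comment> \<open>An infinite set has \<open>card\<close> 0, not 2.\<close>
      then show "finite (common_neighbours G a x)" by (simp add: card_ge_0_finite)
      show "{b, c, d} - {x} \<subseteq> common_neighbours G a x"
        using x arcs d arcs[THEN arcs_symmetric] d[THEN arcs_symmetric]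
        by (auto simp: mem_common_neighbours_iff)
      show "card (common_neighbours G a x) \<le> card ({b, c, d} - {x})"
        using c2 x ne by simp
    qed
    have "{b, c, d} = {x. (a, x) \<in> parcs G}"
    proof (rule neighbourhood_connected)
      fix x y assume "x \<in> {b, c, d}" "(a, y) \<in> parcs G" "(x, y) \<in> parcs G"
      then show "y \<in> {b, c, d}" using cn mem_common_neighbours_iff by blast
    qed (use arcs d in auto)
    then have "out_degree (with_proj G) a = card {b, c, d}" by (simp add: card_neighbours)
    then show False using False ne by simp
  qed
  then show ?thesis using False by (simp only: card.empty if_False)
qed

lemma card_common_neighbours_anti_gallai:
  assumes "(e, f) \<in> parcs (anti_gallai G)" and reg: "regular_graph G k"
  shows "card (common_neighbours (anti_gallai G) e f) = (if k = 3 then 2 else 1)"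
proof -
  obtain a b c where ef: "e = {a, b}" "f = {a, c}"
    and arcs: "(a, b) \<in> parcs G" "(a, c) \<in> parcs G" "(b, c) \<in> parcs G"
    using assms(1) unfolding anti_gallai_arc_iff by blast
  let ?D = "{d. (a, d) \<in> parcs G \<and> (b, d) \<in> parcs G \<and> (c, d) \<in> parcs G}"
  have ne: "a \<noteq> b" "a \<noteq> c" using arcs by auto
  have "finite ?D" using finite_neighbours[of a] by (rule finite_subset[rotated]) auto
  \<comment> \<open>The edges in the image contain \<open>a\<close>; the third side does
    not.\<close>
  moreover have "{b, c} \<notin> (\<lambda>d. {a, d}) ` ?D" using ne by (auto simp: doubleton_eq_iff)
  ultimately have "card (common_neighbours (anti_gallai G) e f) =
      Suc (card ((\<lambda>d. {a, d}) ` ?D))"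
    unfolding ef common_neighbours_anti_gallai[OF arcs] by (intro card_insert_disjoint finite_imageI)
  also have "card ((\<lambda>d. {a, d}) ` ?D) = card ?D"
    by (rule card_image) (auto simp: inj_on_def doubleton_eq_iff)
  also have "out_degree (with_proj G) a = k"
    using reg arcs in_arcsD1 by (auto simp: regular_graph_def)
  then have "card ?D = (if k = 3 then 1 else 0)"
    using card_tetrahedra_on_triangle[OF arcs] by simp
  finally show ?thesis by simp
qed

lemma edge_regular_anti_gallai:
  assumes "regular_graph G k"
  shows "edge_regular (anti_gallai G) (card (edges G)) 4 (if k = 3 then 2 else 1)"
proof -
  have "pverts (anti_gallai G) = edges G" by (simp add: anti_gallai_def)
  then show ?thesis
    unfolding edge_regular_def regular_graph_def
    using pair_graph_anti_gallai out_degree_anti_gallai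
      card_common_neighbours_anti_gallai[OF _ assms]
    by simp
qed

section \<open>Connectedness of the anti-Gallai graph\<close>

text \<open>Adjacent \<open>v\<close>, \<open>w\<close> in N(u) form a triangle with
  \<open>u\<close>, so the edges \<open>{u, v}\<close> and \<open>{u, w}\<close> are adjacent.
  Connectedness of N(u) thus passes to the edges at \<open>u\<close>.\<close>

lemma edges_at_vertex_reachable:
  assumes "(u, x) \<in> parcs G" and "(u, y) \<in> parcs G"
  shows "{u, x} \<rightarrow>\<^sup>*\<^bsub>with_proj (anti_gallai G)\<^esub> {u, y}"
proof -
  interpret H: pair_graph "anti_gallai G" by (rule pair_graph_anti_gallai)
  let ?R = "{y. (u, y) \<in> parcs G \<and> {u, x} \<rightarrow>\<^sup>*\<^bsub>with_proj (anti_gallai G)\<^esub> {u, y}}"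
  have "{u, x} \<in> edges G" using assms(1) by (rule edgesI)
  then have "{u, x} \<in> pverts (anti_gallai G)" by (simp add: anti_gallai_def)
  then have "x \<in> ?R" using assms(1) H.reachable_refl by simp
  have "?R = {y. (u, y) \<in> parcs G}"
  proof (rule neighbourhood_connected)
    show "?R \<noteq> {}" using \<open>x \<in> ?R\<close> by blast
    show "?R \<subseteq> {y. (u, y) \<in> parcs G}" by blast
    fix v w assume "v \<in> ?R" "(u, w) \<in> parcs G" "(v, w) \<in> parcs G"
    then show "w \<in> ?R"
      using anti_gallai_arcI[of u v w] H.reachable_adj_trans[of "{u, x}" "{u, v}" "{u, w}"] by simp
  qed
  then show ?thesis using assms(2) by blast
qed

lemma connected_anti_gallai:
  assumes conn: "connected (with_proj G)" and "parcs G \<noteq> {}"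
  shows "connected (with_proj (anti_gallai G))"
proof -
  interpret H: pair_graph "anti_gallai G" by (rule pair_graph_anti_gallai)
  have verts: "pverts (anti_gallai G) = edges G" by (simp add: anti_gallai_def)
  have "edges G \<noteq> {}" using \<open>parcs G \<noteq> {}\<close> by (auto simp: edges_def)
  moreover have "e \<rightarrow>\<^sup>*\<^bsub>with_proj (anti_gallai G)\<^esub> f" if ef: "e \<in> edges G" "f \<in> edges G" for e f
  proof -
    obtain u x where ux: "e = {u, x}" "(u, x) \<in> parcs G" using ef by (auto simp: edges_def)
    obtain v y where vy: "f = {v, y}" "(v, y) \<in> parcs G" using ef by (auto simp: edges_def)
    have "u \<rightarrow>\<^sup>*\<^bsub>with_proj G\<^esub> v"
      using conn ux vy in_arcsD1 by (simp add: connected_iff_reachable)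
    \<comment> \<open>The claim covers all edges at \<open>v\<close>, so that the induction can use
      the one leading to the next vertex.\<close>
    then have "\<forall>y. (v, y) \<in> parcs G \<longrightarrow> {u, x} \<rightarrow>\<^sup>*\<^bsub>with_proj (anti_gallai G)\<^esub> {v, y}"
    proof (induction rule: reachable_induct)
      case base
      then show ?case using ux edges_at_vertex_reachable by blast
    next
      case (step v w)
      show ?case
      proof (intro allI impI)
        fix y assume "(w, y) \<in> parcs G"
        have vw: "(v, w) \<in> parcs G" using step by simp
        \<comment> \<open>The edge between \<open>v\<close> and \<open>w\<close> is the pivot:
          reached as an edge at \<open>v\<close>, left as an edge at \<open>w\<close>.\<close>
        then have "{u, x} \<rightarrow>\<^sup>*\<^bsub>with_proj (anti_gallai G)\<^esub> {w, v}"
          using step.IH by (metis insert_commute)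
        also have "{w, v} \<rightarrow>\<^sup>*\<^bsub>with_proj (anti_gallai G)\<^esub> {w, y}"
          using vw \<open>(w, y) \<in> parcs G\<close> arc_commute edges_at_vertex_reachable by blast
        finally show "{u, x} \<rightarrow>\<^sup>*\<^bsub>with_proj (anti_gallai G)\<^esub> {w, y}" .
      qed
    qed
    then show ?thesis using ux vy by blast
  qed
  ultimately show ?thesis by (simp add: H.connected_iff_reachable verts)
qed

end

theorem theorem8:
  fixes G :: "'a pair_pre_digraph" and n k \<mu> :: nat
  assumes "strongly_regular G n k 2 \<mu>"
    and "connected (with_proj G)"
    and "k \<ge> 3"
    and "\<forall>u \<in> pverts G. \<exists>!W. wheel_in G u W"
  shows "connected (with_proj (anti_gallai G)) \<and>
    (\<exists>n' k' l'. edge_regular (anti_gallai G) n' k' l')"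
proof -
  have reg: "regular_graph G k" and ne: "parcs G \<noteq> {}"
    and cn: "\<And>u v. (u, v) \<in> parcs G \<Longrightarrow> card (common_neighbours G u v) = 2"
    using assms(1) by (auto simp: strongly_regular_def)
  interpret pair_graph G using reg by (simp add: regular_graph_def)
  \<comment> \<open>The locale demands uniqueness for every \<open>u\<close> of the type, while the
    hypothesis speaks of vertices; a wheel's centre is a vertex.\<close>
  have centre: "u \<in> pverts G" if wheel: "wheel_in G u W" for u W
  proof -
    obtain m and h :: "(nat option, nat option \<times> nat option, 'a, 'a \<times> 'a) digraph_isomorphism"
      where "with_proj W = app_iso h (with_proj (wheel_graph m))" "iso_verts h None = u"
      using wheel unfolding wheel_in_def by blast
    then have "pverts W = iso_verts h ` pverts (wheel_graph m)"
      by (metis verts_app_iso with_proj_simps(1))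
    then have "u \<in> pverts W"
      using \<open>iso_verts h None = u\<close> by (auto simp: wheel_graph_def)
    then show ?thesis using wheel by (auto simp: wheel_in_def subgraph_def)
  qed
  interpret unique_wheel_graph G
    using cn assms(4) centre by unfold_locales blast+
  show ?thesis
    using connected_anti_gallai[OF assms(2) ne] edge_regular_anti_gallai[OF reg] by blast
qed

end
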